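(* Let $n\in\mathbb{N}$ and let $G$ be a subgroup of $\mathrm{Sym}(n)$. Let $S$ be a non-empty subset of $[n]$ and let $S^-=S\setminus\{\max S\}$ be lexicographically minimal in its $G$-orbit. Then $S$ is not lexicographically minimal in its $G$-orbit if and only if at least one of the following cases occurs: I. The set $\mathrm{Dec}(\max S,\max S)\cap\mathrm{Crit}_{S^-}(\infty)$ is non-empty. II. There is an element $i\in S^-$ such that the set $\mathrm{Dec}(\max S,i)\cap\mathrm{Crit}_{S^-}(i)$ is non-empty. III. There is an $i\in S^-$ and a permutation $\pi$ in the set $\mathrm{Hit}(\max S,i)\cap\mathrm{Crit}_{S^-}(i)$ such that $c_S(\pi)\in\pi(S)$.
   Context: $[n]=\{1,\dots,n\}$; permutations act on subsets elementwise; the $G$-orbit of $S$ is $\{\pi(S):\pi\in G\}$. Lexicographic order on subsets: $\emptyset\prec S$ for $S\neq\emptyset$, and for non-empty $S,R$: $S\prec R$ iff $\min S<\min R$, or $\min S=\min R$ and $S\setminus\{\min S\}\prec R\setminus\{\min R\}$. For $S\subseteq[n]$ and $\pi\in G$ the critical element is $c_S(\pi):=\min(S\,\triangle\,\pi(S))\in[n]\cup\{\infty\}$ with $\min\emptyset:=\infty$. For $i,j\in[n]$: $\mathrm{Hit}(i,j):=\{\pi\in G:\pi(i)=j\}$ (hit-element classification) and $\mathrm{Dec}(i,j):=\{\pi\in G:\pi(i)<j\}$ (decreasing-element classification). For $S\subseteq[n]$ and $i\in[n]\cup\{\infty\}$: $\mathrm{Crit}_S(i):=\{\pi\in G: c_S(\pi)=i\}$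 (critical-element classification). *)

theory Defs
  imports "HOL-Algebra.Sym_Groups" "HOL-Library.Extended_Nat"
begin

(* The strict lexicographic order, meant for finite sets only (Min is
   unspecified on infinite sets). On finite sets the recursion is
   well-founded, so the inductive definition pins the relation down uniquely. *)
inductive lex_less :: "nat set \<Rightarrow> nat set \<Rightarrow> bool"  (infix "\<prec>" 50) where
  empty: "S \<noteq> {} \<Longrightarrow> {} \<prec> S"
| Min_less: "S \<noteq> {} \<Longrightarrow> R \<noteq> {} \<Longrightarrow> Min S < Min R \<Longrightarrow> S \<prec> R"
| Min_eq: "S \<noteq> {} \<Longrightarrow> R \<noteq> {} \<Longrightarrow> Min S = Min R \<Longrightarrow>
    S - {Min S} \<prec> R - {Min R} \<Longrightarrow> S \<prec> R"

lemma lex_less_empty_iff: "{} \<prec> S \<longleftrightarrow> S \<noteq> {}" "\<not> S \<prec> {}"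
  by (auto elim: lex_less.cases intro: lex_less.empty)

lemma lex_less_nonempty_iff:
  assumes "S \<noteq> {}" "R \<noteq> {}"
  shows "S \<prec> R \<longleftrightarrow>
    Min S < Min R \<or> Min S = Min R \<and> S - {Min S} \<prec> R - {Min R}"
  using assms by (auto elim: lex_less.cases intro: lex_less.intros)

definition set_orbit :: "(nat \<Rightarrow> nat) set \<Rightarrow> nat set \<Rightarrow> nat set set" where
  "set_orbit G S = {\<pi> ` S | \<pi>. \<pi> \<in> G}"

definition lex_minimal_in_orbit :: "(nat \<Rightarrow> nat) set \<Rightarrow> nat set \<Rightarrow> bool" where
  "lex_minimal_in_orbit G S \<longleftrightarrow> \<not> (\<exists>R \<in> set_orbit G S. R \<prec> S)"

definition crit_elem :: "nat set \<Rightarrow> (nat \<Rightarrow> nat) \<Rightarrow> enat" where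
  "crit_elem S \<pi> =
    (if sym_diff S (\<pi> ` S) = {} then \<infinity> else enat (Min (sym_diff S (\<pi> ` S))))"

definition Hit :: "(nat \<Rightarrow> nat) set \<Rightarrow> nat \<Rightarrow> nat \<Rightarrow> (nat \<Rightarrow> nat) set" where
  "Hit G i j = {\<pi> \<in> G. \<pi> i = j}"

definition Dec :: "(nat \<Rightarrow> nat) set \<Rightarrow> nat \<Rightarrow> nat \<Rightarrow> (nat \<Rightarrow> nat) set" where
  "Dec G i j = {\<pi> \<in> G. \<pi> i < j}"

definition Crit :: "(nat \<Rightarrow> nat) set \<Rightarrow> nat set \<Rightarrow> enat \<Rightarrow> (nat \<Rightarrow> nat) set" where
  "Crit G S i = {\<pi> \<in> G. crit_elem S \<pi> = i}"

end

theory Submission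
  imports Defs
begin

text \<open>Two sets of equal finite size compare lexicographically according to which of them
  contains the least element of their symmetric difference. Write \<open>m\<close> for the maximum of \<open>S\<close>
  and \<open>T = S - {m}\<close>. By minimality of \<open>T\<close>, every \<open>\<pi>\<close> in \<open>G\<close> either fixes \<open>T\<close> or has critical
  element \<open>i \<in> T\<close>. If \<open>\<pi>\<close> fixes \<open>T\<close>, then \<open>\<pi>\<close> decreases \<open>S\<close> iff \<open>\<pi> m < m\<close>. Otherwise it does so
  if \<open>\<pi> m < i\<close>, does not if \<open>\<pi> m > i\<close>, and in the remaining case \<open>\<pi> m = i\<close> the difference at
  \<open>i\<close> is cancelled and the critical element of \<open>S\<close> itself decides.\<close>

text \<open>Induction on the cardinality, removing the common minimum. Equal cardinality excludes
  proper initial segments: \<open>{} \<prec> S\<close> holds for nonempty \<open>S\<close> although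
  \<open>{} - S\<close> has no element \<open>c\<close>.\<close>

lemma lex_less_iff_first_difference:
  assumes "finite R" "finite S" "card R = card S"
  shows "R \<prec> S \<longleftrightarrow> (\<exists>c \<in> R - S. \<forall>x<c. x \<in> R \<longleftrightarrow> x \<in> S)"
  using assms
proof (induction "card S" arbitrary: R S)
  case 0
  then show ?case by (simp add: lex_less_empty_iff)
next
  case (Suc k)
  then have ne: "R \<noteq> {}" "S \<noteq> {}" by auto
  note in_R = Min_in[OF Suc.prems(1) ne(1)] and in_S = Min_in[OF Suc.prems(2) ne(2)]
  have le_R: "Min R \<le> x" if "x \<in> R" for x using that Suc.prems(1) by simp
  have le_S: "Min S \<le> x" if "x \<in> S" for x using that Suc.prems(2) by simp
  consider "Min R < Min S" | "Min S < Min R" | "Min R = Min S" by linarith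
  then show ?case
  proof cases
    case 1
    then have "Min R \<in> R - S" "\<forall>x<Min R. x \<in> R \<longleftrightarrow> x \<in> S"
      using in_R le_R le_S by fastforce+
    with 1 ne show ?thesis by (auto simp: lex_less_nonempty_iff)
  next
    case 2
    \<comment> \<open>Any such \<open>c\<close> is at least \<open>Min R\<close>, hence above
      \<open>Min S\<close>; agreement below \<open>c\<close> would then put \<open>Min S\<close>
      into \<open>R\<close>.\<close>
    have "\<not> (\<exists>c \<in> R - S. \<forall>x<c. x \<in> R \<longleftrightarrow> x \<in> S)"
      using 2 le_R in_S by (metis DiffD1 leD order_less_le_trans)
    with 2 ne show ?thesis by (simp add: lex_less_nonempty_iff)
  next
    case 3
    have "R - {Min R} \<prec> S - {Min S} \<longleftrightarrow>
        (\<exists>c \<in> (R - {Min R}) - (S - {Min S}).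
          \<forall>x<c. x \<in> R - {Min R} \<longleftrightarrow> x \<in> S - {Min S})"
      using Suc.hyps(2) Suc.prems in_R in_S by (intro Suc.hyps(1)) auto
    also have "\<dots> \<longleftrightarrow> (\<exists>c \<in> R - S. \<forall>x<c. x \<in> R \<longleftrightarrow> x \<in> S)"
      using 3 in_R in_S by auto
    finally show ?thesis using 3 ne by (simp add: lex_less_nonempty_iff)
  qed
qed

lemma crit_elem_eq_enat_iff:
  assumes "finite S"
  shows "crit_elem S \<pi> = enat c \<longleftrightarrow>
    c \<in> sym_diff S (\<pi> ` S) \<and> (\<forall>x<c. x \<in> S \<longleftrightarrow> x \<in> \<pi> ` S)"
proof -
  have "finite (sym_diff S (\<pi> ` S))" using assms by simp
  then have "crit_elem S \<pi> = enat c \<longleftrightarrow>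
      c \<in> sym_diff S (\<pi> ` S) \<and> (\<forall>x \<in> sym_diff S (\<pi> ` S). c \<le> x)"
    unfolding crit_elem_def by (auto simp: Min_eq_iff)
  also have "\<dots> \<longleftrightarrow> c \<in> sym_diff S (\<pi> ` S) \<and> (\<forall>x<c. x \<in> S \<longleftrightarrow> x \<in> \<pi> ` S)"
    by (metis DiffD1 DiffD2 DiffI UnCI UnE not_le)
  finally show ?thesis .
qed

lemma crit_elem_eq_infinity_iff: "crit_elem S \<pi> = \<infinity> \<longleftrightarrow> \<pi> ` S = S"
  by (auto simp: crit_elem_def)

lemma image_lex_less_iff_crit_elem:
  assumes "finite S" "inj_on \<pi> S"
  shows "\<pi> ` S \<prec> S \<longleftrightarrow> crit_elem S \<pi> \<in> enat ` (\<pi> ` S)"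
proof -
  have "\<pi> ` S \<prec> S \<longleftrightarrow> (\<exists>c \<in> \<pi> ` S - S. \<forall>x<c. x \<in> \<pi> ` S \<longleftrightarrow> x \<in> S)"
    using assms by (intro lex_less_iff_first_difference) (auto simp: card_image)
  also have "\<dots> \<longleftrightarrow> (\<exists>c \<in> \<pi> ` S. crit_elem S \<pi> = enat c)"
    by (auto simp: crit_elem_eq_enat_iff[OF assms(1)])
  finally show ?thesis by blast
qed

text \<open>This is the criterion for a single permutation; quantifying over the group turns its
  alternatives into the three cases.\<close>

lemma image_insert_lex_less_iff:
  assumes "finite T" "\<forall>x \<in> T. x < m" "inj \<pi>" "\<not> \<pi> ` T \<prec> T"
  shows "\<pi> ` insert m T \<prec> insert m T \<longleftrightarrow>
    \<pi> m < m \<and> crit_elem T \<pi> = \<infinity> \<or>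
    (\<exists>i \<in> T. crit_elem T \<pi> = enat i \<and>
      (\<pi> m < i \<or> \<pi> m = i \<and> crit_elem (insert m T) \<pi> \<in> enat ` (\<pi> ` insert m T)))"
proof -
  let ?S = "insert m T"
  have m: "m \<notin> T" "\<pi> m \<notin> \<pi> ` T" using assms(2,3) by (auto dest: injD)
  have fin: "finite ?S" using assms(1) by simp
  note inj = inj_on_subset[OF assms(3) subset_UNIV]
  have less_iff: "\<pi> ` ?S \<prec> ?S \<longleftrightarrow> (\<exists>c \<in> \<pi> ` ?S - ?S. \<forall>x<c. x \<in> \<pi> ` ?S \<longleftrightarrow> x \<in> ?S)"
    using fin inj by (intro lex_less_iff_first_difference) (auto simp only: card_image finite_imageI)
  show ?thesis
  proof (cases "crit_elem T \<pi>")
    case infinity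
    then have "\<pi> ` T = T" by (simp add: crit_elem_eq_infinity_iff)
    then have "\<pi> ` ?S = insert (\<pi> m) T" "\<pi> m \<notin> T" using m(2) by auto
    \<comment> \<open>Both sets are \<open>T\<close> with one new point, so the smaller new point
      wins.\<close>
    then have "\<pi> ` ?S \<prec> ?S \<longleftrightarrow> \<pi> m < m"
      unfolding less_iff using m(1) by (auto simp: not_less_iff_gr_or_eq)
    with infinity show ?thesis by simp
  next
    case (enat i)
    then have below: "\<forall>x<i. x \<in> T \<longleftrightarrow> x \<in> \<pi> ` T" and diff: "i \<in> sym_diff T (\<pi> ` T)"
      using crit_elem_eq_enat_iff[OF assms(1)] by auto
    \<comment> \<open>Otherwise \<open>\<pi>\<close> would decrease \<open>T\<close>.\<close>
    have "i \<notin> \<pi> ` T"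
      using assms(4) enat image_lex_less_iff_crit_elem[OF assms(1) inj] by auto
    with diff have i: "i \<in> T" "i \<notin> \<pi> ` T" by auto
    then have im: "i < m" using assms(2) by simp
    consider "\<pi> m < i" | "\<pi> m = i" | "i < \<pi> m" by linarith
    then have "\<pi> ` ?S \<prec> ?S \<longleftrightarrow>
        \<pi> m < i \<or> \<pi> m = i \<and> crit_elem ?S \<pi> \<in> enat ` (\<pi> ` ?S)"
    proof cases
      case 1
      then have "\<pi> m \<in> \<pi> ` ?S - ?S" "\<forall>x<\<pi> m. x \<in> \<pi> ` ?S \<longleftrightarrow> x \<in> ?S"
        using below m(2) im by auto
      then have "\<pi> ` ?S \<prec> ?S" unfolding less_iff by blast
      with 1 show ?thesis by simp
    next
      case 2
      then show ?thesis using image_lex_less_iff_crit_elem[OF fin inj] by simp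
    next
      case 3
      \<comment> \<open>Both added points \<open>m\<close> and \<open>\<pi> m\<close> lie above
        \<open>i\<close>, so the first difference stays at \<open>i\<close>.\<close>
      then have "crit_elem ?S \<pi> = enat i"
        using crit_elem_eq_enat_iff[OF fin] below i im by auto
      moreover have "i \<notin> \<pi> ` ?S" using 3 i by auto
      ultimately show ?thesis
        using 3 image_lex_less_iff_crit_elem[OF fin inj] by auto
    qed
    with enat i show ?thesis by auto
  qed
qed

theorem lemma4:
  fixes n :: nat and G :: "(nat \<Rightarrow> nat) set" and S :: "nat set"
  assumes "subgroup G (sym_group n)"
    and "S \<subseteq> {1..n}" and "S \<noteq> {}"
    and "lex_minimal_in_orbit G (S - {Max S})"
  shows "\<not> lex_minimal_in_orbit G S \<longleftrightarrow>
    Dec G (Max S) (Max S) \<inter> Crit G (S - {Max S}) \<infinity> \<noteq> {} \<or>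
    (\<exists>i \<in> S - {Max S}. Dec G (Max S) i \<inter> Crit G (S - {Max S}) (enat i) \<noteq> {}) \<or>
    (\<exists>i \<in> S - {Max S}. \<exists>\<pi> \<in> Hit G (Max S) i \<inter> Crit G (S - {Max S}) (enat i).
      crit_elem S \<pi> \<in> enat ` (\<pi> ` S))"
proof -
  define m T where "m = Max S" and "T = S - {m}"
  have fin: "finite S" using finite_subset[OF assms(2)] by simp
  then have S: "insert m T = S" using Max_in assms(3) by (auto simp: m_def T_def)
  have less: "\<forall>x \<in> T. x < m" using fin by (auto simp: m_def T_def intro: le_neq_trans)
  have inj: "inj \<pi>" if "\<pi> \<in> G" for \<pi>
    using that subgroup.subset[OF assms(1)] permutes_inj by (auto simp: sym_group_def)
  have min: "\<not> \<pi> ` T \<prec> T" if "\<pi> \<in> G" for \<pi>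
    using that assms(4) by (auto simp: lex_minimal_in_orbit_def set_orbit_def T_def m_def)
  have less_iff: "\<pi> ` S \<prec> S \<longleftrightarrow>
      \<pi> m < m \<and> crit_elem T \<pi> = \<infinity> \<or>
      (\<exists>i \<in> T. crit_elem T \<pi> = enat i \<and>
        (\<pi> m < i \<or> \<pi> m = i \<and> crit_elem S \<pi> \<in> enat ` (\<pi> ` S)))" if "\<pi> \<in> G" for \<pi>
    using image_insert_lex_less_iff[OF _ less inj[OF that] min[OF that]] fin
    unfolding S by (simp add: T_def)
  have "\<not> lex_minimal_in_orbit G S \<longleftrightarrow> (\<exists>\<pi> \<in> G. \<pi> ` S \<prec> S)"
    by (auto simp: lex_minimal_in_orbit_def set_orbit_def)
  \<comment> \<open>The criterion is rewritten under the quantifier over \<open>G\<close>, which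
    then distributes over the disjunctions.\<close>
  also note bex_cong[OF refl less_iff]
  also have "(\<exists>\<pi> \<in> G. \<pi> m < m \<and> crit_elem T \<pi> = \<infinity> \<or>
        (\<exists>i \<in> T. crit_elem T \<pi> = enat i \<and>
          (\<pi> m < i \<or> \<pi> m = i \<and> crit_elem S \<pi> \<in> enat ` (\<pi> ` S)))) \<longleftrightarrow>
      Dec G m m \<inter> Crit G T \<infinity> \<noteq> {} \<or>
      (\<exists>i \<in> T. Dec G m i \<inter> Crit G T (enat i) \<noteq> {}) \<or>
      (\<exists>i \<in> T. \<exists>\<pi> \<in> Hit G m i \<inter> Crit G T (enat i). crit_elem S \<pi> \<in> enat ` (\<pi> ` S))"
    unfolding Dec_def Crit_def Hit_def by blast
  finally show ?thesis by (simp only: m_def T_def)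
qed

end
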